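(* Let $X=X_\Sigma$ be a complete normal toric variety over $\mathbb C$ for the torus $T^\vee$. In any integrally balanced divisor class $[D]$ of $X_\Sigma$ there is a unique choice of $T^\vee$-invariant Weil divisor $D'$ such that the tropical critical point $d_{\mathrm{crit}}'$ of $W_{(X,D')}$ is equal to zero.
   Context: $T^\vee$ is a complex torus with cocharacter lattice $M\cong\mathbb Z^r$ and character lattice $N$ (dual to $M$, pairing $\langle\ ,\ \rangle$); $X=X_\Sigma$ for a complete rational polyhedral fan $\Sigma$ in $M_{\mathbb R}=M\otimes\mathbb R$. $v_1,\dots,v_n\in M$ are the primitive generators of the rays of $\Sigma$ and $D_1,\dots,D_n$ the corresponding torus-invariant prime divisors. Linear equivalence of $T^\vee$-invariant Weil divisors is $D'=D+(\chi^d)$ for some $d\in N$, where $(\chi^d)=\sum_i\langle v_i,d\rangle D_i$. $\mathbf K$ is the field of generalised Puiseux series $\sum_kc_{\mu_k}t^{\mu_k}$, $c_{\mu_k}\in\mathbb C$, with real exponents forming a strictly increasing sequence that is finite or tends to $+\infty$; $\operatorname{Val}_{\mathbf K}$ is the lowest exponent with nonzero coefficient; $\mathbf K_{>0}$ is the set of nonzero series with leading coefficient in $\mathbb R_{>0}$. $T$ is the split torus over $\mathbf K$ with character lattice $M$ and cocharacter lattice $N$; $T(\mathbf K_{>0})=\operatorname{Hom}(M,\mathbf K_{>0})$; $\operatorname{Val}_T(p)\in N_{\mathbb R}$ is determined by $\operatorname{Val}_{\mathbf K}(p^v)=\langle v,\operatorname{Val}_T(p)\rangle$ for all $v\in M$.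 To a $T^\vee$-invariant divisor $D=\sum c_iD_i$ is associated the Laurent polynomial $W_D=W_{(X,D)}=\sum_{i=1}^nt^{c_i}x^{v_i}$ on $T$. By completeness of $\Sigma$ its Newton polytope $\operatorname{ConvexHull}(\{v_i\})$ is full-dimensional with $0$ in its interior, so $W_D$ has a unique critical point $p_{\mathrm{crit}}$ in $T(\mathbf K_{>0})$; its tropical critical point is $d_{\mathrm{crit}}=\operatorname{Val}_T(p_{\mathrm{crit}})\in N_{\mathbb R}$. A $T^\vee$-invariant Weil divisor $D$ (with integer coefficients) is integrally balanced if the tropical critical point of $W_D$ lies in $N$; this property depends only on the divisor class $[D]$, and a divisor class is called integrally balanced if its $T^\vee$-invariant representatives are. *)

theory Defs
  imports "HOL-Analysis.Analysis" "HOL-Library.Poly_Mapping"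
begin

section \<open>Generalised Puiseux series\<close>

definition is_gen_puiseux :: "(real \<Rightarrow> complex) \<Rightarrow> bool" where
  "is_gen_puiseux f \<longleftrightarrow>
     finite {x. f x \<noteq> 0} \<or>
     (\<exists>\<mu> :: nat \<Rightarrow> real. strict_mono \<mu> \<and> filterlim \<mu> at_top sequentially \<and> {x. f x \<noteq> 0} \<subseteq> range \<mu>)"

lemma is_gen_puiseux_iff: "is_gen_puiseux f \<longleftrightarrow> (\<forall>B. finite {x. f x \<noteq> 0 \<and> x \<le> B})"
proof
  assume "is_gen_puiseux f"
  then consider "finite {x. f x \<noteq> 0}"
    | \<mu> :: "nat \<Rightarrow> real" where "filterlim \<mu> at_top sequentially" "{x. f x \<noteq> 0} \<subseteq> range \<mu>"
    unfolding is_gen_puiseux_def by blast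
  then show "\<forall>B. finite {x. f x \<noteq> 0 \<and> x \<le> B}"
  proof cases
    case 1
    then show ?thesis by (auto intro: rev_finite_subset)
  next
    case 2
    show ?thesis
    proof
      fix B
      have "eventually (\<lambda>n. \<mu> n > B) sequentially"
        using 2(1) by (simp add: filterlim_at_top_dense)
      then obtain m where m: "\<And>n. n \<ge> m \<Longrightarrow> \<mu> n > B"
        by (auto simp: eventually_sequentially)
      have "{x. f x \<noteq> 0 \<and> x \<le> B} \<subseteq> \<mu> ` {..<m}"
      proof
        fix x assume x: "x \<in> {x. f x \<noteq> 0 \<and> x \<le> B}"
        then obtain n where n: "x = \<mu> n" using 2(2) by auto
        with x m[of n] have "n < m" by force
        with n show "x \<in> \<mu> ` {..<m}" by blast
      qed
      then show "finite {x. f x \<noteq> 0 \<and> x \<le> B}"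
        by (rule finite_subset) simp
    qed
  qed
next
  assume fin: "\<forall>B. finite {x. f x \<noteq> 0 \<and> x \<le> B}"
  define S where "S = {x. f x \<noteq> 0}"
  show "is_gen_puiseux f"
  proof (cases "finite S")
    case True
    then show ?thesis by (simp add: is_gen_puiseux_def S_def)
  next
    case False
    have finB: "finite {x \<in> S. x \<le> B}" for B
      using fin by (simp add: S_def)
    have ex: "\<exists>w. w \<in> S \<and> w > y \<and> (\<forall>x\<in>S. x > y \<longrightarrow> w \<le> x)" for y
    proof -
      obtain z where z: "z \<in> S" "z > y"
      proof (rule ccontr)
        assume "\<not> thesis"
        then have "S = {x \<in> S. x \<le> y}" using that by force
        with finB[of y] False show False by simp
      qed
      define A where "A = {x \<in> S. y < x \<and> x \<le> z}"
      have fA: "finite A" unfolding A_def by (rule finite_subset[OF _ finB[of z]]) auto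
      have zA: "z \<in> A" using z by (simp add: A_def)
      have M: "Min A \<in> A" using fA zA by (auto intro: Min_in)
      have "Min A \<le> x" if "x \<in> S" "x > y" for x
        using Min_le[OF fA, of x] Min_le[OF fA zA] that by (cases "x \<le> z") (auto simp: A_def)
      with M show ?thesis by (auto simp: A_def)
    qed
    define nxt where "nxt y = (SOME w. w \<in> S \<and> w > y \<and> (\<forall>x\<in>S. x > y \<longrightarrow> w \<le> x))" for y
    have nxt: "nxt y \<in> S" "nxt y > y" "\<And>x. x \<in> S \<Longrightarrow> x > y \<Longrightarrow> nxt y \<le> x" for y
      using someI_ex[OF ex[of y]] unfolding nxt_def by blast+
    obtain b where b: "\<And>x. x \<in> S \<Longrightarrow> b < x"
    proof -
      have ne: "{x \<in> S. x \<le> nxt 0} \<noteq> {}" using nxt(1) by auto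
      have "Min {x \<in> S. x \<le> nxt 0} - 1 < x" if "x \<in> S" for x
        using Min_le[OF finB, of x "nxt 0"] Min_in[OF finB ne] that by (cases "x \<le> nxt 0") auto
      then show ?thesis using that by blast
    qed
    define \<mu> where "\<mu> n = (nxt ^^ Suc n) b" for n
    have \<mu>0: "\<mu> 0 = nxt b" and \<mu>S: "\<mu> (Suc n) = nxt (\<mu> n)" for n
      by (simp_all add: \<mu>_def)
    have \<mu>_in: "\<mu> n \<in> S" for n by (cases n) (auto simp: \<mu>0 \<mu>S nxt)
    have mono: "strict_mono \<mu>" by (rule strict_monoI_Suc) (simp add: \<mu>S nxt)
    have unbdd: "\<exists>n. B < \<mu> n" for B
    proof (rule ccontr)
      assume "\<not> ?thesis"
      then have "range \<mu> \<subseteq> {x \<in> S. x \<le> B}" using \<mu>_in by (auto simp: not_less)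
      then have "finite (range \<mu>)" using finB finite_subset by blast
      then show False using strict_mono_imp_inj_on[OF mono] finite_imageD by blast
    qed
    have lim: "filterlim \<mu> at_top sequentially"
      unfolding filterlim_at_top_dense eventually_sequentially
    proof
      fix B
      obtain n where "B < \<mu> n" using unbdd by blast
      then have "\<forall>m\<ge>n. B < \<mu> m"
        using strict_mono_less_eq[OF mono] by (meson less_le_trans)
      then show "\<exists>N. \<forall>n\<ge>N. B < \<mu> n" by blast
    qed
    have "S \<subseteq> range \<mu>"
    proof
      fix x assume x: "x \<in> S"
      define n where "n = (LEAST n. x \<le> \<mu> n)"
      have "\<exists>n. x \<le> \<mu> n" using unbdd less_imp_le by blast
      then have n: "x \<le> \<mu> n" unfolding n_def by (rule LeastI_ex)
      have less: "\<mu> k < x" if "k < n" for k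
        using that not_less_Least unfolding n_def by (metis not_less)
      have "\<mu> n \<le> x"
        by (cases n) (use x b less in \<open>auto simp: \<mu>0 \<mu>S intro!: nxt(3)\<close>)
      with n show "x \<in> range \<mu>" by (metis antisym rangeI)
    qed
    with mono lim show ?thesis by (auto simp: is_gen_puiseux_def S_def)
  qed
qed

typedef gen_puiseux = "{f. is_gen_puiseux f}"
  morphisms gp_coeff Abs_gen_puiseux
  by (rule exI[of _ "\<lambda>_. 0"]) (simp add: is_gen_puiseux_def)

lemma gp_eqI: "(\<And>x. gp_coeff f x = gp_coeff g x) \<Longrightarrow> f = g"
  by (simp add: gp_coeff_inject[symmetric] fun_eq_iff)

lemma finite_gp_coeff_le: "finite {x. gp_coeff f x \<noteq> 0 \<and> x \<le> B}"
  using gp_coeff[of f] by (simp add: is_gen_puiseux_iff)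

lemma gp_coeff_Abs: "(\<And>B. finite {x. f x \<noteq> 0 \<and> x \<le> B}) \<Longrightarrow> gp_coeff (Abs_gen_puiseux f) = f"
  by (simp add: Abs_gen_puiseux_inverse is_gen_puiseux_iff)

lemma gp_bounded_below: "\<exists>m. \<forall>x<m. gp_coeff f x = 0"
proof (cases "{x. gp_coeff f x \<noteq> 0 \<and> x \<le> 0} = {}")
  case True
  then have "\<forall>x<0. gp_coeff f x = 0" by (auto dest: less_imp_le)
  then show ?thesis by blast
next
  case False
  let ?A = "{x. gp_coeff f x \<noteq> 0 \<and> x \<le> 0}"
  have "gp_coeff f x = 0" if "x < Min ?A" for x
  proof (rule ccontr)
    assume nz: "gp_coeff f x \<noteq> 0"
    have "Min ?A \<le> 0" using Min_in[OF finite_gp_coeff_le False] by simp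
    with that nz have "x \<in> ?A" by simp
    with Min_le[OF finite_gp_coeff_le this] that show False by simp
  qed
  then show ?thesis by blast
qed

definition gp_monom :: "complex \<Rightarrow> real \<Rightarrow> gen_puiseux" where
  "gp_monom c \<mu> = Abs_gen_puiseux (\<lambda>x. if x = \<mu> then c else 0)"

lemma gp_coeff_monom: "gp_coeff (gp_monom c \<mu>) x = (if x = \<mu> then c else 0)"
proof -
  have "finite {x. (if x = \<mu> then c else 0) \<noteq> 0 \<and> x \<le> B}" for B
    by (rule finite_subset[of _ "{\<mu>}"]) auto
  from gp_coeff_Abs[OF this] show ?thesis by (simp add: gp_monom_def)
qed

instantiation gen_puiseux :: "{zero,one,plus,minus,uminus,times}"
begin

definition zero_gen_puiseux :: gen_puiseux where "0 = Abs_gen_puiseux (\<lambda>_. 0)"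
definition one_gen_puiseux :: gen_puiseux where "1 = gp_monom 1 0"
definition plus_gen_puiseux :: "gen_puiseux \<Rightarrow> gen_puiseux \<Rightarrow> gen_puiseux" where
  "f + g = Abs_gen_puiseux (\<lambda>x. gp_coeff f x + gp_coeff g x)"
definition minus_gen_puiseux :: "gen_puiseux \<Rightarrow> gen_puiseux \<Rightarrow> gen_puiseux" where
  "f - g = Abs_gen_puiseux (\<lambda>x. gp_coeff f x - gp_coeff g x)"
definition uminus_gen_puiseux :: "gen_puiseux \<Rightarrow> gen_puiseux" where
  "- f = Abs_gen_puiseux (\<lambda>x. - gp_coeff f x)"
definition times_gen_puiseux :: "gen_puiseux \<Rightarrow> gen_puiseux \<Rightarrow> gen_puiseux" where
  "f * g = Abs_gen_puiseux (\<lambda>x.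
     \<Sum>a | gp_coeff f a \<noteq> 0 \<and> gp_coeff g (x - a) \<noteq> 0. gp_coeff f a * gp_coeff g (x - a))"

instance ..

end

lemma gp_coeff_0: "gp_coeff 0 x = 0"
  by (simp add: zero_gen_puiseux_def gp_coeff_Abs)

lemma gp_coeff_1: "gp_coeff 1 x = (if x = 0 then 1 else 0)"
  by (simp add: one_gen_puiseux_def gp_coeff_monom)

lemma gp_coeff_add: "gp_coeff (f + g) x = gp_coeff f x + gp_coeff g x"
proof -
  have "finite {x. gp_coeff f x + gp_coeff g x \<noteq> 0 \<and> x \<le> B}" for B
    by (rule finite_subset[OF _ finite_UnI[OF finite_gp_coeff_le[of f B] finite_gp_coeff_le[of g B]]]) auto
  from gp_coeff_Abs[OF this] show ?thesis by (simp add: plus_gen_puiseux_def)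
qed

lemma gp_coeff_diff: "gp_coeff (f - g) x = gp_coeff f x - gp_coeff g x"
proof -
  have "finite {x. gp_coeff f x - gp_coeff g x \<noteq> 0 \<and> x \<le> B}" for B
    by (rule finite_subset[OF _ finite_UnI[OF finite_gp_coeff_le[of f B] finite_gp_coeff_le[of g B]]]) auto
  from gp_coeff_Abs[OF this] show ?thesis by (simp add: minus_gen_puiseux_def)
qed

lemma gp_coeff_uminus: "gp_coeff (- f) x = - gp_coeff f x"
proof -
  have "finite {x. - gp_coeff f x \<noteq> 0 \<and> x \<le> B}" for B
    using finite_gp_coeff_le[of f B] by simp
  from gp_coeff_Abs[OF this] show ?thesis by (simp add: uminus_gen_puiseux_def)
qed

lemma finite_conv: "finite {a. gp_coeff f a \<noteq> 0 \<and> gp_coeff g (x - a) \<noteq> 0}"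
proof -
  obtain m where m: "\<And>y. y < m \<Longrightarrow> gp_coeff g y = 0" using gp_bounded_below[of g] by blast
  show ?thesis
    by (rule finite_subset[OF _ finite_gp_coeff_le[of f "x - m"]]) (use m in force)
qed

lemma gp_coeff_mult:
  "gp_coeff (f * g) x =
     (\<Sum>a | gp_coeff f a \<noteq> 0 \<and> gp_coeff g (x - a) \<noteq> 0. gp_coeff f a * gp_coeff g (x - a))"
proof -
  let ?h = "\<lambda>x. \<Sum>a | gp_coeff f a \<noteq> 0 \<and> gp_coeff g (x - a) \<noteq> 0. gp_coeff f a * gp_coeff g (x - a)"
  obtain m where m: "\<And>y. y < m \<Longrightarrow> gp_coeff f y = 0" using gp_bounded_below[of f] by blast
  obtain n where n: "\<And>y. y < n \<Longrightarrow> gp_coeff g y = 0" using gp_bounded_below[of g] by blast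
  have "finite {x. ?h x \<noteq> 0 \<and> x \<le> B}" for B
  proof -
    let ?A = "{a. gp_coeff f a \<noteq> 0 \<and> a \<le> B - n}" and ?C = "{c. gp_coeff g c \<noteq> 0 \<and> c \<le> B - m}"
    have "{x. ?h x \<noteq> 0 \<and> x \<le> B} \<subseteq> (\<lambda>(a, c). a + c) ` (?A \<times> ?C)"
    proof
      fix x assume x: "x \<in> {x. ?h x \<noteq> 0 \<and> x \<le> B}"
      then have h: "?h x \<noteq> 0" by (rule CollectE) (rule conjunct1)
      have "{a. gp_coeff f a \<noteq> 0 \<and> gp_coeff g (x - a) \<noteq> 0} \<noteq> {}"
      proof
        assume "{a. gp_coeff f a \<noteq> 0 \<and> gp_coeff g (x - a) \<noteq> 0} = {}"
        then have "?h x = 0" by (simp only: sum.empty)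
        with h show False by (rule notE)
      qed
      then obtain a where a: "gp_coeff f a \<noteq> 0" "gp_coeff g (x - a) \<noteq> 0" by blast
      then have "a \<ge> m" "x - a \<ge> n" using m n by (meson not_le)+
      moreover from x have "x \<le> B" by (rule CollectE) (rule conjunct2)
      ultimately have "(a, x - a) \<in> ?A \<times> ?C" using a by simp
      then show "x \<in> (\<lambda>(a, c). a + c) ` (?A \<times> ?C)"
        by (rule rev_image_eqI) simp
    qed
    then show ?thesis
      by (rule finite_subset) (intro finite_imageI finite_cartesian_product finite_gp_coeff_le)
  qed
  from gp_coeff_Abs[OF this] show ?thesis by (simp add: times_gen_puiseux_def)
qed

lemma gp_coeff_mult_superset:
  assumes "finite A" "\<And>a. gp_coeff f a \<noteq> 0 \<Longrightarrow> gp_coeff g (x - a) \<noteq> 0 \<Longrightarrow> a \<in> A"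
  shows "gp_coeff (f * g) x = (\<Sum>a\<in>A. gp_coeff f a * gp_coeff g (x - a))"
  unfolding gp_coeff_mult by (rule sum.mono_neutral_left) (use assms in auto)

lemma gp_coeff_mult_nonzeroE:
  assumes "gp_coeff (f * g) x \<noteq> 0"
  obtains a where "gp_coeff f a \<noteq> 0" "gp_coeff g (x - a) \<noteq> 0"
proof -
  have "{a. gp_coeff f a \<noteq> 0 \<and> gp_coeff g (x - a) \<noteq> 0} \<noteq> {}"
    using assms unfolding gp_coeff_mult by (metis sum.empty)
  with that show thesis by blast
qed

instance gen_puiseux :: comm_ring_1
proof
  fix f g h :: gen_puiseux
  show "f + g + h = f + (g + h)" by (rule gp_eqI) (simp add: gp_coeff_add)
  show "f + g = g + f" by (rule gp_eqI) (simp add: gp_coeff_add)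
  show "0 + f = f" by (rule gp_eqI) (simp add: gp_coeff_add gp_coeff_0)
  show "- f + f = 0" by (rule gp_eqI) (simp add: gp_coeff_add gp_coeff_0 gp_coeff_uminus)
  show "f - g = f + - g" by (rule gp_eqI) (simp add: gp_coeff_add gp_coeff_diff gp_coeff_uminus)
  show "(0::gen_puiseux) \<noteq> 1"
    by (metis gp_coeff_0 gp_coeff_1 zero_neq_one)
  show "f * g = g * f"
  proof (rule gp_eqI)
    fix x
    show "gp_coeff (f * g) x = gp_coeff (g * f) x"
      unfolding gp_coeff_mult
      by (rule sum.reindex_bij_witness[of _ "\<lambda>a. x - a" "\<lambda>a. x - a"]) auto
  qed
  show "1 * f = f"
  proof (rule gp_eqI)
    fix x
    show "gp_coeff (1 * f) x = gp_coeff f x"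
      by (subst gp_coeff_mult_superset[of "{0}"]) (auto simp: gp_coeff_1 split: if_splits)
  qed
  show "(f + g) * h = f * h + g * h"
  proof (rule gp_eqI)
    fix x
    let ?A = "{a. gp_coeff f a \<noteq> 0 \<and> gp_coeff h (x - a) \<noteq> 0} \<union> {a. gp_coeff g a \<noteq> 0 \<and> gp_coeff h (x - a) \<noteq> 0}"
    have A: "finite ?A" by (intro finite_UnI finite_conv)
    have "gp_coeff ((f + g) * h) x = (\<Sum>a\<in>?A. gp_coeff (f + g) a * gp_coeff h (x - a))"
      by (rule gp_coeff_mult_superset[OF A]) (auto simp: gp_coeff_add)
    moreover have "gp_coeff (f * h) x = (\<Sum>a\<in>?A. gp_coeff f a * gp_coeff h (x - a))"
      by (rule gp_coeff_mult_superset[OF A]) auto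
    moreover have "gp_coeff (g * h) x = (\<Sum>a\<in>?A. gp_coeff g a * gp_coeff h (x - a))"
      by (rule gp_coeff_mult_superset[OF A]) auto
    ultimately show "gp_coeff ((f + g) * h) x = gp_coeff (f * h + g * h) x"
      by (simp only: gp_coeff_add distrib_right sum.distrib)
  qed
  show "f * g * h = f * (g * h)"
  proof (rule gp_eqI)
    fix x
    obtain m where m: "\<And>y. y < m \<Longrightarrow> gp_coeff f y = 0" using gp_bounded_below[of f] by blast
    obtain n where n: "\<And>y. y < n \<Longrightarrow> gp_coeff g y = 0" using gp_bounded_below[of g] by blast
    obtain k where k: "\<And>y. y < k \<Longrightarrow> gp_coeff h y = 0" using gp_bounded_below[of h] by blast
    let ?F = "gp_coeff f" and ?G = "gp_coeff g" and ?H = "gp_coeff h"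
    define A where "A = {a. ?F a \<noteq> 0 \<and> a \<le> x - n - k}"
    define B where "B = {a. ?G a \<noteq> 0 \<and> a \<le> x - m - k}"
    define Y where "Y = (\<lambda>(a, b). a + b) ` (A \<times> B)"
    have fin: "finite A" "finite B" "finite Y"
      unfolding A_def B_def Y_def by (intro finite_imageI finite_cartesian_product finite_gp_coeff_le)+
    have inA: "a \<in> A" if "?F a \<noteq> 0" "?G b \<noteq> 0" "a + b \<le> x - k" for a b
      using that n[of b] by (force simp: A_def)
    have inB: "b \<in> B" if "?F a \<noteq> 0" "?G b \<noteq> 0" "a + b \<le> x - k" for a b
      using that m[of a] by (force simp: B_def)
    have inY: "a + b \<in> Y" if "?F a \<noteq> 0" "?G b \<noteq> 0" "a + b \<le> x - k" for a b
      using inA[OF that] inB[OF that] unfolding Y_def by (intro image_eqI[of _ _ "(a, b)"]) simp_all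
    have hk: "y \<le> x - k" if "?H (x - y) \<noteq> 0" for y
      using that k[of "x - y"] by force
    have fg: "gp_coeff (f * g) y = (\<Sum>a\<in>A. ?F a * ?G (y - a))" if "y \<le> x - k" for y
    proof (rule gp_coeff_mult_superset[OF fin(1)])
      fix a assume "?F a \<noteq> 0" "?G (y - a) \<noteq> 0"
      with that show "a \<in> A" using inA[of a "y - a"] by simp
    qed
    have gh: "gp_coeff (g * h) (x - a) = (\<Sum>y\<in>Y. ?G (y - a) * ?H (x - y))" if "?F a \<noteq> 0" for a
    proof -
      have "gp_coeff (g * h) (x - a) = (\<Sum>b\<in>(\<lambda>y. y - a) ` Y. ?G b * ?H (x - a - b))"
      proof (rule gp_coeff_mult_superset)
        fix b assume "?G b \<noteq> 0" "?H (x - a - b) \<noteq> 0"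
        then have "a + b \<in> Y" using that by (intro inY hk) (simp_all add: diff_diff_add)
        then show "b \<in> (\<lambda>y. y - a) ` Y" by (rule rev_image_eqI) simp
      qed (use fin in simp)
      also have "\<dots> = (\<Sum>y\<in>Y. ?G (y - a) * ?H (x - a - (y - a)))"
        by (rule sum.reindex_cong[of "\<lambda>y. y - a"]) (auto simp: inj_on_def)
      finally show ?thesis by simp
    qed
    have "gp_coeff (f * g * h) x = (\<Sum>y\<in>Y. gp_coeff (f * g) y * ?H (x - y))"
    proof (rule gp_coeff_mult_superset[OF fin(3)])
      fix y assume y: "gp_coeff (f * g) y \<noteq> 0" "?H (x - y) \<noteq> 0"
      obtain a where "?F a \<noteq> 0" "?G (y - a) \<noteq> 0"
        using y(1) by (rule gp_coeff_mult_nonzeroE)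
      then show "y \<in> Y" using inY[of a "y - a"] hk[OF y(2)] by simp
    qed
    also have "\<dots> = (\<Sum>y\<in>Y. (\<Sum>a\<in>A. ?F a * ?G (y - a)) * ?H (x - y))"
    proof (rule sum.cong)
      fix y assume "y \<in> Y"
      show "gp_coeff (f * g) y * ?H (x - y) = (\<Sum>a\<in>A. ?F a * ?G (y - a)) * ?H (x - y)"
        using hk[of y] fg[of y] by (cases "?H (x - y) = 0") auto
    qed simp
    also have "\<dots> = (\<Sum>y\<in>Y. \<Sum>a\<in>A. ?F a * ?G (y - a) * ?H (x - y))"
      by (simp add: sum_distrib_right)
    also have "\<dots> = (\<Sum>a\<in>A. \<Sum>y\<in>Y. ?F a * ?G (y - a) * ?H (x - y))"
      by (rule sum.swap)
    also have "\<dots> = (\<Sum>a\<in>A. ?F a * gp_coeff (g * h) (x - a))"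
      by (rule sum.cong) (auto simp: A_def gh sum_distrib_left mult.assoc)
    also have "\<dots> = gp_coeff (f * (g * h)) x"
    proof (rule gp_coeff_mult_superset[OF fin(1), symmetric])
      fix a assume a: "?F a \<noteq> 0" "gp_coeff (g * h) (x - a) \<noteq> 0"
      obtain b where b: "?G b \<noteq> 0" "?H (x - a - b) \<noteq> 0"
        using a(2) by (rule gp_coeff_mult_nonzeroE)
      have "a + b \<le> x - k" using b(2) by (intro hk) (simp add: diff_diff_add)
      with a(1) b(1) show "a \<in> A" by (rule inA)
    qed
    finally show "gp_coeff (f * g * h) x = gp_coeff (f * (g * h)) x" .
  qed
qed


lemma gp_coeff_mult_cong:
  assumes "\<And>a. gp_coeff f a \<noteq> 0 \<Longrightarrow> gp_coeff g (x - a) = gp_coeff h (x - a)"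
  shows "gp_coeff (f * g) x = gp_coeff (f * h) x"
  unfolding gp_coeff_mult by (rule sum.cong) (use assms in auto)

lemma gp_inverse_one_minus:
  assumes "\<delta> > 0" and g: "\<And>x. x < \<delta> \<Longrightarrow> gp_coeff g x = 0"
  shows "\<exists>v. (1 - g) * v = 1"
proof -
  have pow: "gp_coeff (g ^ n) x = 0" if "x < real n * \<delta>" for n x
    using that
  proof (induction n arbitrary: x)
    case 0
    then show ?case by (simp add: gp_coeff_1)
  next
    case (Suc n)
    show ?case
    proof (rule ccontr)
      assume "gp_coeff (g ^ Suc n) x \<noteq> 0"
      then obtain a where a: "gp_coeff g a \<noteq> 0" "gp_coeff (g ^ n) (x - a) \<noteq> 0"
        unfolding power_Suc by (rule gp_coeff_mult_nonzeroE)
      then have "a \<ge> \<delta>" "x - a \<ge> real n * \<delta>" using g Suc.IH by (meson not_le)+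
      with Suc.prems show False by (simp add: algebra_simps)
    qed
  qed
  define N where "N x = nat (ceiling (x / \<delta>))" for x
  have N: "x < real n * \<delta>" if "n > N x" for x n
  proof -
    have "x / \<delta> \<le> real (N x)" unfolding N_def by linarith
    also have "\<dots> < real n" using that by simp
    finally show ?thesis using assms(1) by (simp add: field_simps)
  qed
  define S where "S k = (\<Sum>n\<le>k. g ^ n)" for k
  have S_Suc: "S (Suc k) = S k + g ^ Suc k" for k by (simp add: S_def)
  have stab: "gp_coeff (S k) x = gp_coeff (S (N x)) x" if "k \<ge> N x" for k x
    using that
  proof (induction rule: dec_induct)
    case (step k)
    then have "gp_coeff (g ^ Suc k) x = 0" by (intro pow N) simp
    with step.IH show ?case by (simp only: S_Suc gp_coeff_add add_0_right)
  qed simp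
  have Nmono: "N x \<le> N y" if "x \<le> y" for x y
    unfolding N_def by (intro nat_mono ceiling_mono divide_right_mono) (use that assms(1) in auto)
  define v where "v = Abs_gen_puiseux (\<lambda>x. gp_coeff (S (N x)) x)"
  have v: "gp_coeff v x = gp_coeff (S (N x)) x" for x
  proof -
    have "finite {x. gp_coeff (S (N x)) x \<noteq> 0 \<and> x \<le> B}" for B
    proof -
      have "gp_coeff (S (N B)) x = gp_coeff (S (N x)) x" if "x \<le> B" for x
        by (rule stab[OF Nmono[OF that]])
      then have "{x. gp_coeff (S (N x)) x \<noteq> 0 \<and> x \<le> B} = {x. gp_coeff (S (N B)) x \<noteq> 0 \<and> x \<le> B}"
        by metis
      then show ?thesis by (simp only: finite_gp_coeff_le)
    qed
    from gp_coeff_Abs[OF this] show ?thesis by (simp add: v_def)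
  qed
  have geo: "(1 - g) * S k = 1 - g ^ Suc k" for k
  proof (induction k)
    case (Suc k)
    have "(1 - g) * S (Suc k) = (1 - g ^ Suc k) + (1 - g) * g ^ Suc k"
      by (simp only: S_Suc distrib_left Suc.IH)
    also have "\<dots> = 1 - g ^ Suc (Suc k)"
      by (simp only: left_diff_distrib mult_1_left power_Suc diff_add_cancel add_diff_eq)
    finally show ?case .
  qed (simp add: S_def)
  have "(1 - g) * v = 1"
  proof (rule gp_eqI)
    fix x
    have "gp_coeff ((1 - g) * v) x = gp_coeff ((1 - g) * S (N x)) x"
    proof (rule gp_coeff_mult_cong)
      fix a assume "gp_coeff (1 - g) a \<noteq> 0"
      then have "a \<ge> 0"
        using g[of a] assms(1) by (cases "a < 0") (auto simp: gp_coeff_diff gp_coeff_1)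
      then show "gp_coeff v (x - a) = gp_coeff (S (N x)) (x - a)"
        unfolding v by (intro stab[symmetric] Nmono) simp
    qed
    also have "\<dots> = gp_coeff 1 x"
      by (simp only: geo gp_coeff_diff pow[OF N[OF lessI]] diff_0_right)
    finally show "gp_coeff ((1 - g) * v) x = gp_coeff 1 x" .
  qed
  then show ?thesis by blast
qed

lemma gp_monom_mult_coeff: "gp_coeff (gp_monom c \<mu> * f) x = c * gp_coeff f (x - \<mu>)"
  by (subst gp_coeff_mult_superset[of "{\<mu>}"]) (auto simp: gp_coeff_monom split: if_splits)

lemma gp_lead_exists:
  assumes "f \<noteq> 0"
  shows "\<exists>m. gp_coeff f m \<noteq> 0 \<and> (\<forall>x<m. gp_coeff f x = 0)"
proof -
  obtain z where z: "gp_coeff f z \<noteq> 0"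
    using assms gp_eqI[of f 0] by (auto simp: gp_coeff_0)
  let ?A = "{x. gp_coeff f x \<noteq> 0 \<and> x \<le> z}"
  have fin: "finite ?A" by (rule finite_gp_coeff_le)
  have M: "Min ?A \<in> ?A" using z fin by (intro Min_in) auto
  have "gp_coeff f x = 0" if "x < Min ?A" for x
  proof (rule ccontr)
    assume "gp_coeff f x \<noteq> 0"
    with that M have "x \<in> ?A" by auto
    with Min_le[OF fin this] that show False by simp
  qed
  with M show ?thesis by blast
qed

lemma gp_inverse_exists:
  assumes "f \<noteq> 0"
  shows "\<exists>v :: gen_puiseux. f * v = 1"
proof -
  obtain m where m: "gp_coeff f m \<noteq> 0" "\<And>x. x < m \<Longrightarrow> gp_coeff f x = 0"
    using gp_lead_exists[OF assms] by blast
  define u where "u = gp_monom (1 / gp_coeff f m) (- m)"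
  define g where "g = 1 - u * f"
  have g0: "gp_coeff g x = 0" if "x \<le> 0" for x
    using that m by (cases "x = 0") (auto simp: g_def u_def gp_coeff_diff gp_coeff_1 gp_monom_mult_coeff)
  have "\<exists>\<delta>>0. \<forall>x<\<delta>. gp_coeff g x = 0"
  proof (cases "g = 0")
    case True
    then show ?thesis by (auto simp: gp_coeff_0 intro: exI[of _ 1])
  next
    case False
    then obtain \<delta> where "gp_coeff g \<delta> \<noteq> 0" "\<forall>x<\<delta>. gp_coeff g x = 0"
      using gp_lead_exists by blast
    with g0 show ?thesis by (meson not_le)
  qed
  then obtain v where "(1 - g) * v = 1" using gp_inverse_one_minus by blast
  then have "f * (u * v) = 1" by (simp add: g_def ac_simps)
  then show ?thesis by blast
qed

instantiation gen_puiseux :: field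
begin

definition inverse_gen_puiseux :: "gen_puiseux \<Rightarrow> gen_puiseux" where
  "inverse (f :: gen_puiseux) = (if f = 0 then 0 else THE g. f * g = 1)"
definition divide_gen_puiseux :: "gen_puiseux \<Rightarrow> gen_puiseux \<Rightarrow> gen_puiseux" where
  "f div g = f * inverse (g :: gen_puiseux)"

instance
proof
  fix f g :: gen_puiseux
  show "inverse f * f = 1" if nz: "f \<noteq> 0"
  proof -
    obtain v where v: "f * v = 1" using gp_inverse_exists[OF nz] by blast
    have "(THE g. f * g = 1) = v"
    proof (rule the_equality)
      fix w assume w: "f * w = 1"
      have "w = (f * v) * w" by (simp add: v)
      also have "\<dots> = (f * w) * v" by (simp add: ac_simps)
      finally show "w = v" by (simp add: w)
    qed (rule v)
    with v nz show ?thesis by (simp add: inverse_gen_puiseux_def mult.commute)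
  qed
qed (simp_all add: divide_gen_puiseux_def inverse_gen_puiseux_def)

end

definition gp_val :: "gen_puiseux \<Rightarrow> real" where
  "gp_val f = (LEAST \<mu>. gp_coeff f \<mu> \<noteq> 0)"

definition gp_pos :: "gen_puiseux set" where
  "gp_pos = {f. f \<noteq> 0 \<and> (\<exists>r>0. gp_coeff f (gp_val f) = complex_of_real r)}"

abbreviation t_pow :: "real \<Rightarrow> gen_puiseux" where
  "t_pow \<mu> \<equiv> gp_monom 1 \<mu>"


section \<open>Lattices and complete toric varieties\<close>

text \<open>
  A basis of \<open>M\<close> and the dual basis of \<open>N\<close> are fixed, so both lattices are \<open>int ^ 'r\<close> and the
  pairing is the standard one; \<open>M\<^sub>\<real>\<close> and \<open>N\<^sub>\<real>\<close> are \<open>real ^ 'r\<close>.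
\<close>

definition lattice_pair :: "int ^ 'r \<Rightarrow> int ^ 'r \<Rightarrow> int" where
  "lattice_pair v d = (\<Sum>i\<in>UNIV. v $ i * d $ i)"

definition lattice_vec :: "int ^ 'r \<Rightarrow> real ^ 'r" where
  "lattice_vec v = (\<chi> i. of_int (v $ i))"

definition rational_polyhedral_cone :: "(real ^ 'r) set \<Rightarrow> bool" where
  "rational_polyhedral_cone C \<longleftrightarrow> (\<exists>S. finite S \<and> C = convex_cone hull (lattice_vec ` S))"

definition strongly_convex :: "(real ^ 'r) set \<Rightarrow> bool" where
  "strongly_convex C \<longleftrightarrow> C \<inter> uminus ` C = {0}"

text \<open>Since \<open>{} face_of C\<close> holds in the library, faces of cones are required to be nonempty.\<close>

definition rational_fan :: "(real ^ 'r) set set \<Rightarrow> bool" where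
  "rational_fan \<Sigma> \<longleftrightarrow> finite \<Sigma>
     \<and> (\<forall>C\<in>\<Sigma>. rational_polyhedral_cone C \<and> strongly_convex C)
     \<and> (\<forall>C\<in>\<Sigma>. \<forall>F. F face_of C \<and> F \<noteq> {} \<longrightarrow> F \<in> \<Sigma>)
     \<and> (\<forall>C\<in>\<Sigma>. \<forall>C'\<in>\<Sigma>. C \<inter> C' face_of C \<and> C \<inter> C' face_of C')"

definition complete_fan :: "(real ^ 'r) set set \<Rightarrow> bool" where
  "complete_fan \<Sigma> \<longleftrightarrow> rational_fan \<Sigma> \<and> \<Union>\<Sigma> = UNIV"

definition fan_rays :: "(real ^ 'r) set set \<Rightarrow> (real ^ 'r) set set" where
  "fan_rays \<Sigma> = {\<rho>\<in>\<Sigma>. dim \<rho> = 1}"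

definition primitive :: "int ^ 'r \<Rightarrow> bool" where
  "primitive v \<longleftrightarrow> Gcd (range (\<lambda>i. v $ i)) = 1"

definition ray_gen :: "(real ^ 'r) set \<Rightarrow> int ^ 'r" where
  "ray_gen \<rho> = (THE v. primitive v \<and> lattice_vec v \<in> \<rho>)"

text \<open>
  The torus-invariant prime divisors of \<open>X\<^sub>\<Sigma>\<close> correspond to the rays of \<open>\<Sigma>\<close>; the invariant Weil
  divisor \<open>\<Sum> c\<^sub>\<rho> D\<^sub>\<rho>\<close> is the element \<open>\<Sum> c\<^sub>\<rho> \<rho>\<close> of the free abelian group on the set of rays.
\<close>

type_synonym 'r toric_divisor = "(real ^ 'r) set \<Rightarrow>\<^sub>0 int"

definition invariant_divisors :: "(real ^ 'r) set set \<Rightarrow> 'r toric_divisor set" where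
  "invariant_divisors \<Sigma> = {D. Poly_Mapping.keys D \<subseteq> fan_rays \<Sigma>}"

definition character_divisor :: "(real ^ 'r) set set \<Rightarrow> int ^ 'r \<Rightarrow> 'r toric_divisor" where
  "character_divisor \<Sigma> d = (\<Sum>\<rho>\<in>fan_rays \<Sigma>. frag_cmul (lattice_pair (ray_gen \<rho>) d) (frag_of \<rho>))"

definition linear_equivalence :: "(real ^ 'r) set set \<Rightarrow> 'r toric_divisor rel" where
  "linear_equivalence \<Sigma> = {(D, D'). D \<in> invariant_divisors \<Sigma> \<and> D' \<in> invariant_divisors \<Sigma>
     \<and> (\<exists>d. D' = D + character_divisor \<Sigma> d)}"


section \<open>Laurent polynomials over \<open>\<^bold>K\<close> and positive critical points\<close>

text \<open>A Laurent polynomial on \<open>T\<close> is a finitely supported function on the character lattice \<open>M\<close>.\<close>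

type_synonym 'r laurent = "int ^ 'r \<Rightarrow>\<^sub>0 gen_puiseux"

text \<open>
  Points of \<open>T\<close> over \<open>\<^bold>K\<^sub>>\<^sub>0\<close> are homomorphisms from \<open>M\<close> to \<open>\<^bold>K\<^sub>>\<^sub>0\<close>; so \<open>p v\<close> is the value \<open>p\<^sup>v\<close> of
  the character \<open>x\<^sup>v\<close>.
\<close>

definition torus_pos :: "(int ^ 'r \<Rightarrow> gen_puiseux) set" where
  "torus_pos = {p. (\<forall>v. p v \<in> gp_pos) \<and> (\<forall>v w. p (v + w) = p v * p w)}"

definition torus_val :: "(int ^ 'r \<Rightarrow> gen_puiseux) \<Rightarrow> real ^ 'r" where
  "torus_val p = (THE d. \<forall>v. gp_val (p v) = lattice_vec v \<bullet> d)"

definition laurent_eval :: "'r::finite laurent \<Rightarrow> (int ^ 'r \<Rightarrow> gen_puiseux) \<Rightarrow> gen_puiseux" where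
  "laurent_eval W p = (\<Sum>v\<in>Poly_Mapping.keys W. Poly_Mapping.lookup W v * p v)"

text \<open>Partial derivative with respect to the coordinate \<open>x\<^sub>j = x\<^bsup>e\<^sub>j\<^esup>\<close>.\<close>

definition laurent_pderiv :: "'r::finite \<Rightarrow> 'r laurent \<Rightarrow> 'r laurent" where
  "laurent_pderiv j W = (\<Sum>v\<in>Poly_Mapping.keys W.
     Poly_Mapping.single (v - axis j 1) (of_int (v $ j) * Poly_Mapping.lookup W v))"

definition pos_critical_point :: "'r::finite laurent \<Rightarrow> (int ^ 'r \<Rightarrow> gen_puiseux) \<Rightarrow> bool" where
  "pos_critical_point W p \<longleftrightarrow> p \<in> torus_pos \<and> (\<forall>j. laurent_eval (laurent_pderiv j W) p = 0)"

text \<open>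
  For the polynomials \<open>superpotential \<Sigma> D\<close> below, with \<open>\<Sigma>\<close> complete, there is exactly one positive
  critical point, so at most one \<open>d\<close> satisfies the following relation.
\<close>

definition tropical_critical_point :: "'r::finite laurent \<Rightarrow> real ^ 'r \<Rightarrow> bool" where
  "tropical_critical_point W d \<longleftrightarrow> (\<exists>p. pos_critical_point W p \<and> torus_val p = d)"

definition superpotential :: "(real ^ 'r) set set \<Rightarrow> 'r toric_divisor \<Rightarrow> 'r laurent" where
  "superpotential \<Sigma> D = (\<Sum>\<rho>\<in>fan_rays \<Sigma>.
     Poly_Mapping.single (ray_gen \<rho>) (t_pow (of_int (Poly_Mapping.lookup D \<rho>))))"

definition integrally_balanced :: "(real ^ 'r) set set \<Rightarrow> 'r toric_divisor \<Rightarrow> bool" where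
  "integrally_balanced \<Sigma> D \<longleftrightarrow>
     (\<exists>d. tropical_critical_point (superpotential \<Sigma> D) (lattice_vec d))"

definition integrally_balanced_class :: "(real ^ 'r) set set \<Rightarrow> 'r toric_divisor set \<Rightarrow> bool" where
  "integrally_balanced_class \<Sigma> \<C> \<longleftrightarrow> (\<forall>D\<in>\<C>. integrally_balanced \<Sigma> D)"

end

theory Submission
  imports Defs
begin

text \<open>
  If \<open>p\<close> is a positive critical point of \<open>W\<^sub>D\<close>, then \<open>v \<mapsto> t\<^bsup>-\<langle>v,d\<rangle>\<^esup> p\<^sup>v\<close> is one of
  \<open>W\<^bsub>D + (\<chi>\<^sup>d)\<^esub>\<close>, and its valuation is smaller by \<open>d\<close>; this gives existence. For uniqueness, let
  \<open>p\<close> and \<open>q\<close> be positive critical points of valuation \<open>0\<close> for \<open>D\<close> and \<open>D + (\<chi>\<^sup>e)\<close>. The terms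
  \<open>y\<^sub>i\<close> and \<open>z\<^sub>i\<close> of the two polynomials at these points have valuations \<open>c\<^sub>i\<close> and
  \<open>c\<^sub>i + \<langle>v\<^sub>i,e\<rangle>\<close>, and criticality means \<open>\<Sum> y\<^sub>i v\<^sub>i = 0 = \<Sum> z\<^sub>i v\<^sub>i\<close>. Pairing with \<open>e\<close> gives
  \<open>\<Sum> \<langle>v\<^sub>i,e\<rangle> (y\<^sub>i - z\<^sub>i) = 0\<close>. The leading term of \<open>y\<^sub>i - z\<^sub>i\<close> comes from \<open>y\<^sub>i\<close> if \<open>\<langle>v\<^sub>i,e\<rangle> > 0\<close>
  and from \<open>-z\<^sub>i\<close> if \<open>\<langle>v\<^sub>i,e\<rangle> < 0\<close>, so every summand with \<open>\<langle>v\<^sub>i,e\<rangle> \<noteq> 0\<close> is positive. Hence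
  all \<open>\<langle>v\<^sub>i,e\<rangle>\<close> vanish, that is, \<open>(\<chi>\<^sup>e) = 0\<close>.
\<close>

section \<open>Leading terms and positivity of generalised Puiseux series\<close>

lemma gp_val_eqI:
  assumes "gp_coeff f m \<noteq> 0" "\<And>x. x < m \<Longrightarrow> gp_coeff f x = 0"
  shows "gp_val f = m"
  unfolding gp_val_def by (rule Least_equality) (use assms leI in blast)+

lemma gp_coeff_less_val: "x < gp_val f \<Longrightarrow> gp_coeff f x = 0"
\<comment> \<open>The valuation of zero is an unspecified real, but there every coefficient vanishes
  anyway.\<close>
proof (cases "f = 0")
  case False
  then obtain m where "gp_coeff f m \<noteq> 0" "\<And>x. x < m \<Longrightarrow> gp_coeff f x = 0"
    using gp_lead_exists by blast
  then show "x < gp_val f \<Longrightarrow> gp_coeff f x = 0"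
    using gp_val_eqI by blast
qed (simp add: gp_coeff_0)

lemma gp_pos_valI:
  assumes "gp_coeff f m = of_real r" "r > 0" "\<And>x. x < m \<Longrightarrow> gp_coeff f x = 0"
  shows "f \<in> gp_pos" "gp_val f = m"
proof -
  have nz: "gp_coeff f m \<noteq> 0" using assms by simp
  then show val: "gp_val f = m" using assms(3) by (rule gp_val_eqI)
  have "f \<noteq> 0" using nz by (auto simp: gp_coeff_0)
  with val assms show "f \<in> gp_pos" by (auto simp: gp_pos_def)
qed

lemma gp_posE:
  assumes "f \<in> gp_pos"
  obtains r where "gp_coeff f (gp_val f) = of_real r" "r > 0"
  using assms by (auto simp: gp_pos_def)

text \<open>At the exponent \<open>gp_val f\<close> and below, \<open>g\<close> has no terms, so the
  leading term of \<open>f\<close> survives.\<close>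

lemma gp_pos_diff:
  assumes "f \<in> gp_pos" "gp_val f < gp_val g"
  shows "f - g \<in> gp_pos"
proof -
  obtain r where "gp_coeff f (gp_val f) = of_real r" "r > 0"
    using assms(1) by (rule gp_posE)
  with assms(2) show ?thesis
    by (intro gp_pos_valI(1)[of _ "gp_val f" r]) (auto simp: gp_coeff_diff gp_coeff_less_val)
qed

lemma gp_pos_add:
  assumes f: "f \<in> gp_pos" and g: "g \<in> gp_pos"
  shows "f + g \<in> gp_pos"
proof -
  obtain r where r: "gp_coeff f (gp_val f) = of_real r" "r > 0"
    using f by (rule gp_posE)
  obtain s where s: "gp_coeff g (gp_val g) = of_real s" "s > 0"
    using g by (rule gp_posE)
  define m where "m = min (gp_val f) (gp_val g)"
  \<comment> \<open>The coefficient of the sum at \<open>m\<close>: only series whose valuation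
    attains the minimum contribute. In a tie both do, and positivity of \<open>r\<close> and
    \<open>s\<close> excludes cancellation.\<close>
  define u where "u = (if gp_val f \<le> gp_val g then r else 0) + (if gp_val g \<le> gp_val f then s else 0)"
  show ?thesis
    by (rule gp_pos_valI(1)[of _ m u])
      (use r s in \<open>auto simp: m_def u_def min_def gp_coeff_add gp_coeff_less_val split: if_splits\<close>)
qed

lemma gp_pos_sum:
  assumes "finite A" "A \<noteq> {}" "\<And>a. a \<in> A \<Longrightarrow> f a \<in> gp_pos"
  shows "sum f A \<in> gp_pos"
  using assms by (induction A rule: finite_ne_induct) (auto intro: gp_pos_add)

lemma gp_pos_val_mult:
  assumes f: "f \<in> gp_pos" and g: "g \<in> gp_pos"
  shows "f * g \<in> gp_pos" "gp_val (f * g) = gp_val f + gp_val g"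
proof -
  let ?m = "gp_val f" and ?n = "gp_val g"
  obtain r where r: "gp_coeff f ?m = of_real r" "r > 0"
    using f by (rule gp_posE)
  obtain s where s: "gp_coeff g ?n = of_real s" "s > 0"
    using g by (rule gp_posE)
  \<comment> \<open>At this exponent any split other than \<open>?m\<close> plus \<open>?n\<close>
    puts one factor below its valuation, so the convolution has a single term.\<close>
  have "gp_coeff (f * g) (?m + ?n) = (\<Sum>a\<in>{?m}. gp_coeff f a * gp_coeff g (?m + ?n - a))"
  proof (rule gp_coeff_mult_superset)
    fix a assume "gp_coeff f a \<noteq> 0" "gp_coeff g (?m + ?n - a) \<noteq> 0"
    then have "\<not> a < ?m" "\<not> ?m + ?n - a < ?n" using gp_coeff_less_val by blast+
    then show "a \<in> {?m}" by simp
  qed simp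
  then have lead: "gp_coeff (f * g) (?m + ?n) = of_real (r * s)"
    by (simp add: r s)
  have low: "gp_coeff (f * g) x = 0" if "x < ?m + ?n" for x
  proof (rule ccontr)
    assume "gp_coeff (f * g) x \<noteq> 0"
    then obtain a where "gp_coeff f a \<noteq> 0" "gp_coeff g (x - a) \<noteq> 0"
      by (rule gp_coeff_mult_nonzeroE)
    then have "\<not> a < ?m" "\<not> x - a < ?n" using gp_coeff_less_val by blast+
    with that show False by simp
  qed
  show "f * g \<in> gp_pos" "gp_val (f * g) = ?m + ?n"
    using gp_pos_valI[OF lead _ low] r s by auto
qed

lemma t_pow_pos: "t_pow \<mu> \<in> gp_pos"
  and gp_val_t_pow: "gp_val (t_pow \<mu>) = \<mu>"
  using gp_pos_valI[of "t_pow \<mu>" \<mu> 1] by (auto simp: gp_coeff_monom)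

lemma t_pow_add: "t_pow (\<mu> + \<nu>) = t_pow \<mu> * t_pow \<nu>"
  by (rule gp_eqI) (auto simp: gp_monom_mult_coeff gp_coeff_monom)

lemma t_pow_0: "t_pow 0 = 1"
  by (simp add: one_gen_puiseux_def)

lemma of_nat_pos: "n > 0 \<Longrightarrow> of_nat n \<in> gp_pos"
proof (induction n rule: nat_induct_non_zero)
  case 1
  then show ?case using t_pow_pos[of 0] by (simp add: t_pow_0)
next
  case (Suc n)
  then show ?case using gp_pos_add[OF _ Suc.IH, of 1] t_pow_pos[of 0] by (simp add: t_pow_0)
qed

lemma of_int_pos: "k > 0 \<Longrightarrow> of_int k \<in> gp_pos"
  using of_nat_pos[of "nat k"] by simp

section \<open>The lattice pairing and valuations of torus points\<close>

lemma lattice_pair_add_left: "lattice_pair (v + w) d = lattice_pair v d + lattice_pair w d"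
  and lattice_pair_diff_right: "lattice_pair v (d - e) = lattice_pair v d - lattice_pair v e"
  by (simp_all add: lattice_pair_def algebra_simps sum.distrib sum_subtractf)

lemma lattice_pair_zero_right: "lattice_pair v 0 = 0"
  by (simp add: lattice_pair_def)

lemma lattice_vec_inner: "lattice_vec v \<bullet> lattice_vec d = of_int (lattice_pair v d)"
  by (simp add: lattice_vec_def lattice_pair_def inner_vec_def)

lemma lattice_vec_axis: "lattice_vec (axis i 1) = axis i 1"
  by (simp add: lattice_vec_def axis_def vec_eq_iff)

text \<open>A homomorphism on a free abelian group is determined by its values on the standard
  basis; these form the representing vector.\<close>

lemma additive_lattice_eq:
  fixes f :: "int ^ 'r::finite \<Rightarrow> real"
  assumes add: "\<And>v w. f (v + w) = f v + f w"
  shows "f v = lattice_vec v \<bullet> (\<chi> i. f (axis i 1))"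
proof -
  interpret additive f by unfold_locales (rule add)
  have axis: "f (axis i k) = of_int k * f (axis i 1)" for i k
  proof (induction k rule: int_induct[of _ 0])
    case base
    then show ?case using zero by (simp add: zero_vec_def axis_def)
  next
    case (step1 k)
    have "axis i (k + 1) = axis i k + axis i (1::int)" by (simp add: axis_def vec_eq_iff)
    with step1 show ?case by (simp add: add algebra_simps)
  next
    case (step2 k)
    have "axis i (k - 1) = axis i k - axis i (1::int)" by (simp add: axis_def vec_eq_iff)
    with step2 show ?case by (simp only: diff) (simp add: algebra_simps)
  qed
  have "v = (\<Sum>i\<in>UNIV. axis i (v $ i))"
    by (simp add: vec_eq_iff axis_def if_distrib cong: if_cong)
  then have "f v = (\<Sum>i\<in>UNIV. f (axis i (v $ i)))"
    by (metis sum)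
  also have "\<dots> = (\<Sum>i\<in>UNIV. of_int (v $ i) * f (axis i 1))"
    by (subst axis) (rule refl)
  finally show ?thesis by (simp add: lattice_vec_def inner_vec_def)
qed

lemma torus_val_eqI:
  assumes "\<And>v. gp_val (p v) = lattice_vec v \<bullet> d"
  shows "torus_val p = d"
  unfolding torus_val_def
proof (rule the_equality)
  fix e assume e: "\<forall>v. gp_val (p v) = lattice_vec v \<bullet> e"
  have "e $ i = d $ i" for i
    using e assms[of "axis i 1"] by (simp add: lattice_vec_axis inner_axis')
  then show "e = d" by (simp add: vec_eq_iff)
qed (use assms in blast)

text \<open>Valuation turns products of positive series into sums, so \<open>gp_val (p v)\<close> is
  additive in \<open>v\<close> and hence represented by a vector. This justifies the definite
  description in \<open>torus_val\<close>.\<close>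

lemma gp_val_torus_pos:
  assumes "p \<in> torus_pos"
  shows "gp_val (p v) = lattice_vec v \<bullet> torus_val p"
proof -
  have "gp_val (p (v + w)) = gp_val (p v) + gp_val (p w)" for v w
    using assms by (simp add: torus_pos_def gp_pos_val_mult)
  note eq = additive_lattice_eq[of "\<lambda>v. gp_val (p v)", OF this]
  show ?thesis unfolding torus_val_eqI[of p, OF eq] by (rule eq)
qed

section \<open>Evaluation of Laurent polynomials and the critical equations\<close>

lemma laurent_eval_superset:
  assumes "finite A" "Poly_Mapping.keys W \<subseteq> A"
  shows "laurent_eval W p = (\<Sum>v\<in>A. Poly_Mapping.lookup W v * p v)"
  unfolding laurent_eval_def
  by (rule sum.mono_neutral_left) (use assms in \<open>auto simp: in_keys_iff\<close>)

lemma laurent_eval_add: "laurent_eval (V + W) p = laurent_eval V p + laurent_eval W p"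
proof -
  let ?A = "Poly_Mapping.keys V \<union> Poly_Mapping.keys W"
  have "Poly_Mapping.keys (V + W) \<subseteq> ?A" by (rule Poly_Mapping.keys_add)
  then show ?thesis
    by (simp add: laurent_eval_superset[of ?A] lookup_add distrib_right sum.distrib)
qed

lemma laurent_eval_sum: "laurent_eval (sum W A) p = (\<Sum>a\<in>A. laurent_eval (W a) p)"
  by (induction A rule: infinite_finite_induct) (simp_all add: laurent_eval_add laurent_eval_def[of 0])

lemma laurent_eval_single: "laurent_eval (Poly_Mapping.single v c) p = c * p v"
  by (subst laurent_eval_superset[of "{v}"]) auto

text \<open>Since \<open>laurent_eval\<close> accepts any function on the lattice, weight and shift
  can pass from the polynomial to the function. The right side is additive in \<open>W\<close>, so
  sums over rays are evaluated term by term.\<close>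

lemma laurent_eval_pderiv:
  "laurent_eval (laurent_pderiv j W) p = laurent_eval W (\<lambda>v. of_int (v $ j) * p (v - axis j 1))"
  by (simp add: laurent_pderiv_def laurent_eval_sum laurent_eval_single laurent_eval_def[of W] ac_simps)

lemma torus_pos_diff:
  assumes "p \<in> torus_pos"
  shows "p v = p (v - w) * p w"
proof -
  have "p (v - w + w) = p (v - w) * p w" using assms unfolding torus_pos_def by blast
  then show ?thesis by simp
qed

text \<open>Multiplying by the nonzero \<open>p (axis j 1)\<close> replaces each partial derivative
  by the logarithmic one, which weights every monomial term by the \<open>j\<close>-th coordinate of
  its exponent.\<close>

lemma pos_critical_point_superpotential:
  "pos_critical_point (superpotential \<Sigma> D) p \<longleftrightarrow> p \<in> torus_pos \<and>
     (\<forall>j. (\<Sum>\<rho>\<in>fan_rays \<Sigma>. of_int (ray_gen \<rho> $ j) *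
        (t_pow (of_int (Poly_Mapping.lookup D \<rho>)) * p (ray_gen \<rho>))) = 0)"
proof -
  have "laurent_eval (laurent_pderiv j (superpotential \<Sigma> D)) p = 0 \<longleftrightarrow>
      (\<Sum>\<rho>\<in>fan_rays \<Sigma>. of_int (ray_gen \<rho> $ j) *
        (t_pow (of_int (Poly_Mapping.lookup D \<rho>)) * p (ray_gen \<rho>))) = 0"
    (is "?L = 0 \<longleftrightarrow> ?R = 0") if "p \<in> torus_pos" for j
  proof -
    have "?L * p (axis j 1) = ?R"
      unfolding laurent_eval_pderiv superpotential_def laurent_eval_sum laurent_eval_single
        sum_distrib_right torus_pos_diff[OF that, of "ray_gen _" "axis j 1"]
      by (rule sum.cong) (simp_all only: ac_simps)
    moreover have "p (axis j 1) \<noteq> 0"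
      using that by (auto simp: torus_pos_def gp_pos_def)
    ultimately show ?thesis by (metis mult_eq_0_iff)
  qed
  then show ?thesis
    unfolding pos_critical_point_def by blast
qed

section \<open>Divisors of characters\<close>

lemma lookup_character_divisor:
  assumes "finite (fan_rays \<Sigma>)"
  shows "Poly_Mapping.lookup (character_divisor \<Sigma> d) \<rho> =
    (if \<rho> \<in> fan_rays \<Sigma> then lattice_pair (ray_gen \<rho>) d else 0)"
proof -
  have "Poly_Mapping.lookup (character_divisor \<Sigma> d) \<rho> =
      (\<Sum>\<sigma>\<in>fan_rays \<Sigma>. if \<sigma> = \<rho> then lattice_pair (ray_gen \<sigma>) d else 0)"
    unfolding character_divisor_def lookup_sum by (rule sum.cong) auto
  also have "\<dots> = (if \<rho> \<in> fan_rays \<Sigma> then lattice_pair (ray_gen \<rho>) d else 0)"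
    using assms by simp
  finally show ?thesis .
qed

lemma character_divisor_diff:
  assumes "finite (fan_rays \<Sigma>)"
  shows "character_divisor \<Sigma> (d - e) = character_divisor \<Sigma> d - character_divisor \<Sigma> e"
  by (rule poly_mapping_eqI)
    (simp add: lookup_character_divisor[OF assms] lookup_minus lattice_pair_diff_right)

lemma invariant_divisors_add_character:
  assumes "finite (fan_rays \<Sigma>)" "D \<in> invariant_divisors \<Sigma>"
  shows "D + character_divisor \<Sigma> d \<in> invariant_divisors \<Sigma>"
proof -
  have "Poly_Mapping.keys (character_divisor \<Sigma> d) \<subseteq> fan_rays \<Sigma>"
    by (auto simp: in_keys_iff lookup_character_divisor[OF assms(1)] split: if_splits)
  with assms(2) Poly_Mapping.keys_add[of D "character_divisor \<Sigma> d"] show ?thesis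
    unfolding invariant_divisors_def by blast
qed

section \<open>Existence and uniqueness of the balanced representative\<close>

lemma tropical_critical_point_add_character:
  assumes fin: "finite (fan_rays \<Sigma>)"
    and "tropical_critical_point (superpotential \<Sigma> D) (lattice_vec d)"
  shows "tropical_critical_point (superpotential \<Sigma> (D + character_divisor \<Sigma> d)) 0"
proof -
  obtain p where p: "pos_critical_point (superpotential \<Sigma> D) p" "torus_val p = lattice_vec d"
    using assms(2) unfolding tropical_critical_point_def by blast
  from p(1) have pos: "p \<in> torus_pos" by (simp add: pos_critical_point_def)
  define q where "q v = t_pow (- of_int (lattice_pair v d)) * p v" for v
  have "q (v + w) = q v * q w" for v w
    using pos t_pow_add[of "- of_int (lattice_pair v d)" "- of_int (lattice_pair w d)"]
    by (simp add: q_def torus_pos_def lattice_pair_add_left ac_simps)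
  then have "q \<in> torus_pos"
    using pos by (simp add: torus_pos_def q_def gp_pos_val_mult t_pow_pos)
  \<comment> \<open>The twist in \<open>q\<close> cancels the change of the divisor, so each term of
    the polynomial keeps its value and the critical equations carry over.\<close>
  moreover have "t_pow (of_int (Poly_Mapping.lookup (D + character_divisor \<Sigma> d) \<rho>)) * q (ray_gen \<rho>)
      = t_pow (of_int (Poly_Mapping.lookup D \<rho>)) * p (ray_gen \<rho>)" if "\<rho> \<in> fan_rays \<Sigma>" for \<rho>
    using that by (simp add: q_def lookup_add lookup_character_divisor[OF fin]
        mult.assoc[symmetric] t_pow_add[symmetric])
  ultimately have "pos_critical_point (superpotential \<Sigma> (D + character_divisor \<Sigma> d)) q"
    using p(1) by (simp add: pos_critical_point_superpotential)
  moreover have "torus_val q = 0"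
  proof (rule torus_val_eqI)
    fix v
    have "p v \<in> gp_pos" using pos by (simp add: torus_pos_def)
    then show "gp_val (q v) = lattice_vec v \<bullet> 0"
      by (simp add: q_def gp_pos_val_mult t_pow_pos gp_val_t_pow gp_val_torus_pos[OF pos] p(2)
          lattice_vec_inner)
  qed
  ultimately show ?thesis unfolding tropical_critical_point_def by blast
qed

lemma character_divisor_eq_0:
  assumes fin: "finite (fan_rays \<Sigma>)"
    and D: "tropical_critical_point (superpotential \<Sigma> D) 0"
    and D': "tropical_critical_point (superpotential \<Sigma> (D + character_divisor \<Sigma> e)) 0"
  shows "character_divisor \<Sigma> e = 0"
proof -
  let ?D' = "D + character_divisor \<Sigma> e" and ?R = "fan_rays \<Sigma>"
  obtain p where p: "pos_critical_point (superpotential \<Sigma> D) p" "torus_val p = 0"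
    using D unfolding tropical_critical_point_def by blast
  obtain q where q: "pos_critical_point (superpotential \<Sigma> ?D') q" "torus_val q = 0"
    using D' unfolding tropical_critical_point_def by blast
  define n where "n \<rho> = lattice_pair (ray_gen \<rho>) e" for \<rho>
  define y where "y \<rho> = t_pow (of_int (Poly_Mapping.lookup D \<rho>)) * p (ray_gen \<rho>)" for \<rho>
  define z where "z \<rho> = t_pow (of_int (Poly_Mapping.lookup ?D' \<rho>)) * q (ray_gen \<rho>)" for \<rho>
  have pos: "p \<in> torus_pos" "q \<in> torus_pos"
    using p(1) q(1) by (simp_all add: pos_critical_point_def)
  then have pos': "p v \<in> gp_pos" "q v \<in> gp_pos" for v
    by (simp_all add: torus_pos_def)
  have yz: "y \<rho> \<in> gp_pos" "z \<rho> \<in> gp_pos" for \<rho>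
    by (simp_all add: y_def z_def gp_pos_val_mult t_pow_pos pos')
  \<comment> \<open>Both points have valuation \<open>0\<close>, so the valuation of each term is
    just its divisor coefficient.\<close>
  have val: "gp_val (z \<rho>) = gp_val (y \<rho>) + of_int (n \<rho>)" if "\<rho> \<in> ?R" for \<rho>
    using that by (simp add: y_def z_def n_def gp_pos_val_mult t_pow_pos pos' gp_val_t_pow
        gp_val_torus_pos pos p(2) q(2) lookup_add lookup_character_divisor[OF fin])
  \<comment> \<open>Expanding the pairing in coordinates and swapping sums exhibits a combination of
    the critical equations with coefficients \<open>e $ j\<close>.\<close>
  have "(\<Sum>\<rho>\<in>?R. of_int (n \<rho>) * (y \<rho> - z \<rho>)) =
      (\<Sum>\<rho>\<in>?R. \<Sum>j\<in>UNIV. of_int (e $ j) * (of_int (ray_gen \<rho> $ j) * y \<rho> - of_int (ray_gen \<rho> $ j) * z \<rho>))"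
    by (simp add: n_def lattice_pair_def sum_distrib_left sum_subtractf algebra_simps)
  also have "\<dots> = (\<Sum>j\<in>UNIV. of_int (e $ j) * ((\<Sum>\<rho>\<in>?R. of_int (ray_gen \<rho> $ j) * y \<rho>)
      - (\<Sum>\<rho>\<in>?R. of_int (ray_gen \<rho> $ j) * z \<rho>)))"
    by (subst sum.swap) (simp only: sum_distrib_left[symmetric] sum_subtractf)
  also have "\<dots> = 0"
    using p(1) q(1) by (simp add: pos_critical_point_superpotential y_def z_def)
  finally have sum0: "(\<Sum>\<rho>\<in>?R. of_int (n \<rho>) * (y \<rho> - z \<rho>)) = 0" .
  have term_pos: "of_int (n \<rho>) * (y \<rho> - z \<rho>) \<in> gp_pos" if "\<rho> \<in> ?R" "n \<rho> \<noteq> 0" for \<rho>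
  proof (cases "n \<rho> > 0")
    case True
    then have "y \<rho> - z \<rho> \<in> gp_pos" using val[OF that(1)] yz by (intro gp_pos_diff) auto
    with True show ?thesis by (simp add: gp_pos_val_mult of_int_pos)
  next
    case False
    then have "z \<rho> - y \<rho> \<in> gp_pos" using val[OF that(1)] yz that(2) by (intro gp_pos_diff) auto
    moreover have "of_int (- n \<rho>) \<in> gp_pos" using False that(2) by (intro of_int_pos) simp
    ultimately have "of_int (- n \<rho>) * (z \<rho> - y \<rho>) \<in> gp_pos" by (simp only: gp_pos_val_mult)
    then show ?thesis by (simp add: algebra_simps)
  qed
  \<comment> \<open>A nonempty sum of positive series is positive, hence nonzero, which contradicts
    \<open>sum0\<close>.\<close>
  have "{\<rho> \<in> ?R. n \<rho> \<noteq> 0} = {}"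
  proof (rule ccontr)
    assume ne: "{\<rho> \<in> ?R. n \<rho> \<noteq> 0} \<noteq> {}"
    have "(\<Sum>\<rho>\<in>{\<rho> \<in> ?R. n \<rho> \<noteq> 0}. of_int (n \<rho>) * (y \<rho> - z \<rho>)) \<in> gp_pos"
      by (rule gp_pos_sum) (use fin ne term_pos in auto)
    also have "(\<Sum>\<rho>\<in>{\<rho> \<in> ?R. n \<rho> \<noteq> 0}. of_int (n \<rho>) * (y \<rho> - z \<rho>)) = 0"
      unfolding sum0[symmetric] by (rule sum.mono_neutral_left) (use fin in auto)
    finally show False by (simp add: gp_pos_def)
  qed
  then show ?thesis
    by (intro poly_mapping_eqI) (auto simp: lookup_character_divisor[OF fin] n_def)
qed

theorem corollary6p3:
  fixes \<Sigma> :: "(real ^ 'r::finite) set set"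
    and \<C> :: "'r toric_divisor set"
  assumes "complete_fan \<Sigma>"
    and "\<C> \<in> invariant_divisors \<Sigma> // linear_equivalence \<Sigma>"
    and "integrally_balanced_class \<Sigma> \<C>"
  shows "\<exists>!D'. D' \<in> \<C> \<and> tropical_critical_point (superpotential \<Sigma> D') 0"
proof -
  have fin: "finite (fan_rays \<Sigma>)"
    using assms(1) by (simp add: complete_fan_def rational_fan_def fan_rays_def)
  obtain D where D: "D \<in> invariant_divisors \<Sigma>" and C: "\<C> = linear_equivalence \<Sigma> `` {D}"
    using assms(2) by (rule quotientE)
  \<comment> \<open>The class is the whole orbit of \<open>D\<close> under adding divisors of
    characters, because these keep the support in the rays.\<close>
  have mem: "D' \<in> \<C> \<longleftrightarrow> (\<exists>d. D' = D + character_divisor \<Sigma> d)" for D'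
    using D invariant_divisors_add_character[OF fin D] by (auto simp: C linear_equivalence_def)
  have "character_divisor \<Sigma> 0 = 0"
    by (simp add: character_divisor_def lattice_pair_zero_right)
  then have "D \<in> \<C>" unfolding mem by (metis add_0_right)
  then obtain d where d: "tropical_critical_point (superpotential \<Sigma> D) (lattice_vec d)"
    using assms(3) by (auto simp: integrally_balanced_class_def integrally_balanced_def)
  show ?thesis
  proof (rule ex_ex1I)
    show "\<exists>D'. D' \<in> \<C> \<and> tropical_critical_point (superpotential \<Sigma> D') 0"
      using tropical_critical_point_add_character[OF fin d] mem by blast
  next
    fix D1 D2
    assume 1: "D1 \<in> \<C> \<and> tropical_critical_point (superpotential \<Sigma> D1) 0"
      and 2: "D2 \<in> \<C> \<and> tropical_critical_point (superpotential \<Sigma> D2) 0"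
    then obtain a b where "D1 = D + character_divisor \<Sigma> a" "D2 = D + character_divisor \<Sigma> b"
      unfolding mem by blast
    then have D2: "D2 = D1 + character_divisor \<Sigma> (b - a)"
      by (simp add: character_divisor_diff[OF fin])
    with 1 2 have "character_divisor \<Sigma> (b - a) = 0"
      using character_divisor_eq_0[OF fin] by blast
    with D2 show "D1 = D2" by simp
  qed
qed

end
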